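(* The following statements are equivalent. (B) Every finite lattice is isomorphic to an interval in the subgroup lattice of a finite group. (C) Suppose $n\geqslant 2$ and $\mathscr{L}=\{L_1,\dots,L_n\}$ is a set of finite lattices, at least two of which have more than two elements. For each $i=1,2,\dots,n$, let $\mathfrak{X}_i$ denote the class that is core-free interval enforceable by $L_i$. Then there exists a finite group $G\in\bigcap_{i=1}^n\mathfrak{X}_i$ such that for each $L_i\in\mathscr{L}$ we have $L_i\cong[H_i,G]$ for some subgroup $H_i$, where every subgroup $Y$ with $H_i\leqslant Y<G$ is core-free in $G$.
   Context: All groups and lattices are finite. For a subgroup $H$ of a group $G$, the interval $[H,G]$ is the set $\{K\mid H\leqslant K\leqslant G\}$ of subgroups, ordered by inclusion; it is a sublattice of the lattice $\mathrm{Sub}(G)$ of all subgroups of $G$. $Y<G$ means that $Y$ is a proper subgroup of $G$. The core $\mathrm{core}_G(H)$ is the largest normal subgroup of $G$ contained in $H$, and $H$ is core-free in $G$ if $\mathrm{core}_G(H)=1$. A class of groups is a collection of groups closed under isomorphism. A class of groups $\mathfrak{X}$ is core-free interval enforceable by a finite lattice $L$ if for every finite group $G$ and every subgroup $H\leqslant G$ with $L\cong[H,G]$ and $\mathrm{core}_G(H)=1$, we have $G\in\mathfrak{X}$.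
   Formalization: In (C) each lattice L_i is also required to have at least two elements (a one-element L_i forces G trivial, making (C) as printed false); finite lattices and groups are taken with carriers in the natural numbers, and the X_i range over all classes enforceable by L_i. *)

theory Defs
  imports "HOL-Algebra.Algebra"
begin

text \<open>
  Lattices are the order structures of \<open>HOL-Algebra\<close>. The locale \<open>lattice\<close> only asks for binary
  suprema and infima of carrier elements, so nonemptiness has to be required separately. Since the
  statement quantifies over all finite lattices and all finite groups inside a formula, these live
  on the carrier type \<open>nat\<close>, which represents every finite structure up to isomorphism; the values
  of operations and relations outside the carrier are irrelevant.
\<close>

definition finite_lattice :: "'a gorder \<Rightarrow> bool" where
  "finite_lattice L \<longleftrightarrow> lattice L \<and> finite (carrier L) \<and> carrier L \<noteq> {}"

definition finite_group :: "('a, 'b) monoid_scheme \<Rightarrow> bool" where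
  "finite_group G \<longleftrightarrow> group G \<and> finite (carrier G)"

text \<open>A lattice isomorphism is the same as a bijection preserving and reflecting the order.\<close>

definition lattice_isomorphic :: "'a gorder \<Rightarrow> 'b gorder \<Rightarrow> bool" where
  "lattice_isomorphic L M \<longleftrightarrow>
     (\<exists>f. bij_betw f (carrier L) (carrier M) \<and>
          (\<forall>x\<in>carrier L. \<forall>y\<in>carrier L. x \<sqsubseteq>\<^bsub>L\<^esub> y \<longleftrightarrow> f x \<sqsubseteq>\<^bsub>M\<^esub> f y))"

definition subgroup_interval :: "('a, 'b) monoid_scheme \<Rightarrow> 'a set \<Rightarrow> 'a set gorder" where
  "subgroup_interval G H = \<lparr>carrier = {K. subgroup K G \<and> H \<subseteq> K}, eq = (=), le = (\<subseteq>)\<rparr>"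

definition core :: "('a, 'b) monoid_scheme \<Rightarrow> 'a set \<Rightarrow> 'a set" where
  "core G H = (GREATEST N. N \<lhd> G \<and> N \<subseteq> H)"

definition core_free :: "('a, 'b) monoid_scheme \<Rightarrow> 'a set \<Rightarrow> bool" where
  "core_free G H \<longleftrightarrow> core G H = {\<one>\<^bsub>G\<^esub>}"

definition group_class :: "nat monoid set \<Rightarrow> bool" where
  "group_class \<XX> \<longleftrightarrow>
     (\<forall>G\<in>\<XX>. finite_group G) \<and> (\<forall>G\<in>\<XX>. \<forall>K. group K \<and> G \<cong> K \<longrightarrow> K \<in> \<XX>)"

definition cf_interval_enforceable :: "nat monoid set \<Rightarrow> nat gorder \<Rightarrow> bool" where
  "cf_interval_enforceable \<XX> L \<longleftrightarrow>
     group_class \<XX> \<and>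
     (\<forall>G H. finite_group G \<and> subgroup H G \<and> lattice_isomorphic L (subgroup_interval G H) \<and>
            core_free G H \<longrightarrow> G \<in> \<XX>)"

text \<open>The maximum defining the core exists: it is the intersection of all conjugates.\<close>

lemma core_greatest:
  fixes G (structure)
  assumes "group G" and H: "subgroup H G"
  shows "core G H \<lhd> G" "core G H \<subseteq> H" "\<And>N. N \<lhd> G \<Longrightarrow> N \<subseteq> H \<Longrightarrow> N \<subseteq> core G H"
proof -
  interpret group G by fact
  let ?C = "{x \<in> carrier G. \<forall>g\<in>carrier G. g \<otimes> x \<otimes> inv g \<in> H}"
  have sub: "subgroup ?C G"
  proof (unfold_locales, goal_cases)
    case 1 then show ?case by auto
  next
    case (2 x y)
    have "g \<otimes> (x \<otimes> y) \<otimes> inv g \<in> H" if g: "g \<in> carrier G" for g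
    proof -
      have "g \<otimes> (x \<otimes> y) \<otimes> inv g = (g \<otimes> x \<otimes> inv g) \<otimes> (g \<otimes> y \<otimes> inv g)"
        using 2 g by (simp add: m_assoc inv_solve_left)
      then show ?thesis using 2 g subgroup.m_closed[OF H] by auto
    qed
    with 2 show ?case by auto
  next
    case 3 then show ?case using subgroup.one_closed[OF H] by simp
  next
    case (4 x)
    have "g \<otimes> inv x \<otimes> inv g \<in> H" if g: "g \<in> carrier G" for g
    proof -
      have "g \<otimes> inv x \<otimes> inv g = inv (g \<otimes> x \<otimes> inv g)"
        using 4 g by (simp add: inv_mult_group m_assoc)
      then show ?thesis using 4 g subgroup.m_inv_closed[OF H] by auto
    qed
    with 4 show ?case by auto
  qed
  have norm: "?C \<lhd> G"
  proof (rule iffD2[OF normal_inv_iff, OF conjI, OF sub], intro ballI)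
    fix x h assume x: "x \<in> carrier G" and h: "h \<in> ?C"
    have "g \<otimes> (x \<otimes> h \<otimes> inv x) \<otimes> inv g \<in> H" if g: "g \<in> carrier G" for g
    proof -
      have "g \<otimes> (x \<otimes> h \<otimes> inv x) \<otimes> inv g = (g \<otimes> x) \<otimes> h \<otimes> inv (g \<otimes> x)"
        using x h g by (simp add: inv_mult_group m_assoc)
      then show ?thesis using x h g by simp
    qed
    then show "x \<otimes> h \<otimes> inv x \<in> ?C" using x h by auto
  qed
  have CH: "?C \<subseteq> H"
  proof
    fix x assume "x \<in> ?C"
    then have "x \<in> carrier G" "\<one> \<otimes> x \<otimes> inv \<one> \<in> H" by blast+
    then show "x \<in> H" by simp
  qed
  have max: "N \<subseteq> ?C" if "N \<lhd> G" "N \<subseteq> H" for N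
  proof
    fix x assume "x \<in> N"
    then show "x \<in> ?C"
      using that normal.inv_op_closed2[OF that(1)] subgroup.mem_carrier[OF normal_imp_subgroup[OF that(1)]]
      by blast
  qed
  have "core G H = ?C"
    unfolding core_def by (rule Greatest_equality) (use norm CH max in auto)
  then show "core G H \<lhd> G" "core G H \<subseteq> H" "\<And>N. N \<lhd> G \<Longrightarrow> N \<subseteq> H \<Longrightarrow> N \<subseteq> core G H"
    using norm CH max by simp_all
qed

text \<open>
  A one-element lattice is isomorphic to \<open>[H, G]\<close> only for \<open>H = G\<close>, and \<open>G\<close> is core-free in itself
  only if it is trivial. So a one-element lattice enforces triviality, which is incompatible with
  representing any other lattice. Families of lattices to be represented jointly must therefore
  consist of lattices with at least two elements.
\<close>

lemma cf_interval_enforceable_trivial: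
  fixes L :: "nat gorder"
  assumes "card (carrier L) = 1"
  shows "cf_interval_enforceable {G. group G \<and> card (carrier G) = 1} L"
proof -
  have "card (carrier G) = 1"
    if fg: "finite_group G" and H: "subgroup H G" and cf: "core_free G H"
      and iso: "lattice_isomorphic L (subgroup_interval G H)" for G :: "nat monoid" and H
  proof -
    interpret group G using fg by (simp add: finite_group_def)
    have "card (carrier (subgroup_interval G H)) = 1"
      using iso assms by (metis lattice_isomorphic_def bij_betw_same_card)
    moreover have "H \<in> carrier (subgroup_interval G H)" "carrier G \<in> carrier (subgroup_interval G H)"
      using H subgroup.subset[OF H] subgroup_self by (auto simp: subgroup_interval_def)
    ultimately have "H = carrier G"
      by (metis card_1_singletonE singletonD)
    moreover have "carrier G \<lhd> G"
      by (simp add: normal_inv_iff subgroup_self)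
    ultimately have "carrier G \<subseteq> core G H"
      using core_greatest(3)[OF is_group H] by simp
    then have "carrier G = {\<one>\<^bsub>G\<^esub>}" using cf by (auto simp: core_free_def)
    then show ?thesis by simp
  qed
  moreover have "group_class {G :: nat monoid. group G \<and> card (carrier G) = 1}"
    unfolding group_class_def finite_group_def
    by (auto simp: card_eq_0_iff dest: iso_same_card intro: card_ge_0_finite)
  ultimately show ?thesis
    by (auto simp: cf_interval_enforceable_def finite_group_def)
qed

end

theory Submission
  imports Defs
begin

text \<open>
  Condition (B) speaks of one lattice at a time, (C) of several lattices that must be found above
  subgroups of one and the same group. What links them is the \<^emph>\<open>parachute\<close> of \<open>L\<^sub>1, \<dots>, L\<^sub>n\<close>: a single
  finite lattice in which disjoint copies of the \<open>L\<^sub>i\<close> hang from a common top element, with a new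
  bottom element below all of them.

  Assume (B), and represent the parachute as an interval \<open>[H, G]\<close>. Factoring out the core of \<open>H\<close>
  does not change the interval, so \<open>H\<close> may be taken to be core-free
  (\<open>core_free_nat_quotient\<close>). The bottom of the copy of \<open>L\<^sub>i\<close> is then a subgroup \<open>K\<^sub>i\<close> with
  \<open>[K\<^sub>i, G] \<cong> L\<^sub>i\<close>. The shape of the parachute forces \<open>N H = G\<close> for every normal subgroup \<open>N \<noteq> 1\<close>
  (\<open>normal_set_mult_eq_carrier\<close>). Indeed \<open>N H \<noteq> H\<close> because \<open>H\<close> is core-free. If \<open>N H\<close> were
  a proper subgroup, it would lie in the copy of some \<open>L\<^sub>i\<close>. Among the two lattices with more than
  two elements there is an \<open>L\<^sub>j\<close> with \<open>j \<noteq> i\<close>, so that there are \<open>Y < Y' < G\<close> in the copy of \<open>L\<^sub>j\<close>.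
  Elements of different copies have join \<open>G\<close> and meet \<open>H\<close>, hence \<open>N Y = G\<close> and
  \<open>N \<inter> Y' \<subseteq> H \<subseteq> Y\<close>, and the Dedekind law \<open>Y' = (N \<inter> Y') Y\<close> gives \<open>Y' = Y\<close>, a contradiction.
  So a proper subgroup \<open>Y \<ge> H\<close> contains no normal subgroup \<open>N \<noteq> 1\<close>, as otherwise
  \<open>G = N H \<subseteq> Y\<close>. In particular each \<open>K\<^sub>i\<close> is core-free, which puts \<open>G\<close> into \<open>\<XX>\<^sub>i\<close>, and all proper
  subgroups above \<open>K\<^sub>i\<close> are core-free too.

  Conversely, the class of all finite groups is enforceable by every lattice, so (C) represents any
  lattice \<open>L\<close> with at least two elements, once it is accompanied by two copies of some lattice with
  more than two elements; the parachute of \<open>L, L\<close> is one. A one-element lattice is the interval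
  \<open>[G, G]\<close>.
\<close>

section \<open>Finite lattices and their copies\<close>

definition family_order :: "'a set set \<Rightarrow> 'a set gorder" where
  "family_order F = \<lparr>carrier = F, eq = (=), le = (\<subseteq>)\<rparr>"

lemma lattice_isomorphic_trans:
  assumes "lattice_isomorphic L M" "lattice_isomorphic M K"
  shows "lattice_isomorphic L K"
proof -
  obtain f where f: "bij_betw f (carrier L) (carrier M)"
    "\<forall>x\<in>carrier L. \<forall>y\<in>carrier L. x \<sqsubseteq>\<^bsub>L\<^esub> y \<longleftrightarrow> f x \<sqsubseteq>\<^bsub>M\<^esub> f y"
    using assms(1) unfolding lattice_isomorphic_def by blast
  obtain g where g: "bij_betw g (carrier M) (carrier K)"
    "\<forall>x\<in>carrier M. \<forall>y\<in>carrier M. x \<sqsubseteq>\<^bsub>M\<^esub> y \<longleftrightarrow> g x \<sqsubseteq>\<^bsub>K\<^esub> g y"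
    using assms(2) unfolding lattice_isomorphic_def by blast
  show ?thesis
    unfolding lattice_isomorphic_def
    using bij_betw_trans[OF f(1) g(1)] f g bij_betwE[OF f(1)]
    by (intro exI[of _ "g \<circ> f"]) simp
qed

text \<open>
  Brings lattices built on other types, such as families of sets, within reach of statements about
  lattices on the natural numbers.
\<close>

lemma finite_lattice_nat_copy:
  fixes L :: "'a gorder"
  assumes "finite_lattice L"
  obtains M :: "nat gorder" where "finite_lattice M" "lattice_isomorphic L M"
proof -
  interpret L: lattice L using assms by (simp add: finite_lattice_def)
  obtain f :: "'a \<Rightarrow> nat" where inj: "inj_on f (carrier L)"
    using assms finite_imp_inj_to_nat_seg[of "carrier L"] by (auto simp: finite_lattice_def)
  define g where "g = inv_into (carrier L) f"
  define M :: "nat gorder" where "M = \<lparr>carrier = f ` carrier L, eq = (=), le = \<lambda>a b. g a \<sqsubseteq>\<^bsub>L\<^esub> g b\<rparr>"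
  have g[simp]: "g (f x) = x" if "x \<in> carrier L" for x
    using inj that by (simp add: g_def)
  have M: "carrier M = f ` carrier L" "(.=\<^bsub>M\<^esub>) = (=)"
    "x \<sqsubseteq>\<^bsub>M\<^esub> y \<longleftrightarrow> g x \<sqsubseteq>\<^bsub>L\<^esub> g y" for x y
    by (simp_all add: M_def)
  have "partial_order M"
    by unfold_locales (auto simp: M intro: L.le_antisym L.le_trans dest: L.le_antisym)
  moreover have "\<exists>s. least M s (Upper M {x, y})" if xy: "x \<in> carrier M" "y \<in> carrier M" for x y
  proof -
    have car: "g x \<in> carrier L" "g y \<in> carrier L" using xy by (auto simp: M)
    then obtain s where "least L s (Upper L {g x, g y})"
      using L.sup_of_two_exists by blast
    moreover have "Upper M {x, y} = f ` Upper L {g x, g y}"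
      using xy car by (auto simp: M Upper_def)
    ultimately have "least M (f s) (Upper M {x, y})"
      by (auto simp: M least_def Upper_def)
    then show ?thesis ..
  qed
  moreover have "\<exists>s. greatest M s (Lower M {x, y})" if xy: "x \<in> carrier M" "y \<in> carrier M" for x y
  proof -
    have car: "g x \<in> carrier L" "g y \<in> carrier L" using xy by (auto simp: M)
    then obtain s where "greatest L s (Lower L {g x, g y})"
      using L.inf_of_two_exists by blast
    moreover have "Lower M {x, y} = f ` Lower L {g x, g y}"
      using xy car by (auto simp: M Lower_def)
    ultimately have "greatest M (f s) (Lower M {x, y})"
      by (auto simp: M greatest_def Lower_def)
    then show ?thesis ..
  qed
  ultimately have "lattice M"
    by (simp add: lattice_def upper_semilattice_def lower_semilattice_def
        upper_semilattice_axioms_def lower_semilattice_axioms_def)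
  then have "finite_lattice M"
    using assms by (simp add: finite_lattice_def M)
  moreover have "lattice_isomorphic L M"
    unfolding lattice_isomorphic_def
    by (rule exI[of _ f]) (auto simp: M inj bij_betw_def)
  ultimately show ?thesis ..
qed

text \<open>
  Binary meets are intersections. The join of two members is the intersection of all members that
  contain both; the greatest member ensures that there is one.
\<close>

lemma finite_lattice_intersection_family:
  assumes fin: "finite F" and top: "T \<in> F" "\<And>A. A \<in> F \<Longrightarrow> A \<subseteq> T"
    and Int: "\<And>A B. A \<in> F \<Longrightarrow> B \<in> F \<Longrightarrow> A \<inter> B \<in> F"
  shows "finite_lattice (family_order F)"
proof -
  have "partial_order (family_order F)"
    unfolding family_order_def by unfold_locales auto
  moreover have "\<exists>s. least (family_order F) s (Upper (family_order F) {A, B})"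
    if "A \<in> F" "B \<in> F" for A B
  proof -
    define S where "S = {C \<in> F. A \<union> B \<subseteq> C}"
    have S: "finite S" "S \<subseteq> F"
      using fin by (simp_all add: S_def)
    have "T \<in> S" using top that by (simp add: S_def)
    then have "S \<noteq> {}" by blast
    have "\<Inter>S \<in> F"
      using S(1) \<open>S \<noteq> {}\<close> S(2) by (induction rule: finite_ne_induct) (auto intro: Int)
    moreover have "A \<union> B \<subseteq> \<Inter>S" by (auto simp: S_def)
    ultimately have "\<Inter>S \<in> S" by (simp add: S_def)
    moreover have "Upper (family_order F) {A, B} = S"
      using that by (auto simp: Upper_def S_def family_order_def)
    ultimately have "least (family_order F) (\<Inter>S) (Upper (family_order F) {A, B})"
      using S(2) by (simp add: least_def family_order_def Inter_lower)
    then show ?thesis ..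
  qed
  moreover have "\<exists>s. greatest (family_order F) s (Lower (family_order F) {A, B})"
    if "A \<in> F" "B \<in> F" for A B
  proof -
    have "Lower (family_order F) {A, B} = {C \<in> F. C \<subseteq> A \<inter> B}"
      using that by (auto simp: Lower_def family_order_def)
    then have "greatest (family_order F) (A \<inter> B) (Lower (family_order F) {A, B})"
      using Int[OF that] by (auto simp: greatest_def family_order_def)
    then show ?thesis ..
  qed
  ultimately have "lattice (family_order F)"
    by (simp add: lattice_def upper_semilattice_def lower_semilattice_def
        upper_semilattice_axioms_def lower_semilattice_axioms_def family_order_def)
  then show ?thesis
    using fin top by (auto simp: finite_lattice_def family_order_def)
qed

lemma finite_lattice_bounds:
  assumes "finite_lattice L"
  obtains b t where "b \<in> carrier L" "\<And>x. x \<in> carrier L \<Longrightarrow> b \<sqsubseteq>\<^bsub>L\<^esub> x"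
    "t \<in> carrier L" "\<And>x. x \<in> carrier L \<Longrightarrow> x \<sqsubseteq>\<^bsub>L\<^esub> t"
proof -
  interpret L: lattice L using assms by (simp add: finite_lattice_def)
  have "finite (carrier L)" "carrier L \<noteq> {}"
    using assms by (simp_all add: finite_lattice_def)
  then have "least L (\<Squnion>\<^bsub>L\<^esub>carrier L) (Upper L (carrier L))"
    "greatest L (\<Sqinter>\<^bsub>L\<^esub>carrier L) (Lower L (carrier L))"
    by (simp_all add: L.finite_sup_least L.finite_inf_greatest)
  then show ?thesis
    by (intro that[of "\<Sqinter>\<^bsub>L\<^esub>carrier L" "\<Squnion>\<^bsub>L\<^esub>carrier L"])
      (auto simp: least_def greatest_def Upper_def Lower_def)
qed

section \<open>The parachute of a family of lattices\<close>

definition down :: "'a gorder \<Rightarrow> 'a \<Rightarrow> 'a set" where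
  "down L x = {z \<in> carrier L. z \<sqsubseteq>\<^bsub>L\<^esub> x}"

text \<open>
  An element is determined by its principal ideal, and meets become intersections. So a lattice can
  be handled as a family of sets, and the parachute can be formed by disjoint union of sets.
\<close>

lemma down_subset_iff:
  assumes "lattice L" "x \<in> carrier L" "y \<in> carrier L"
  shows "down L x \<subseteq> down L y \<longleftrightarrow> x \<sqsubseteq>\<^bsub>L\<^esub> y"
proof -
  interpret lattice L by fact
  show ?thesis using assms(2,3) le_trans by (auto simp: down_def)
qed

lemma down_meet:
  assumes "lattice L" "x \<in> carrier L" "y \<in> carrier L"
  obtains z where "z \<in> carrier L" "down L z = down L x \<inter> down L y"
proof -
  interpret lattice L by fact
  have "down L (x \<sqinter>\<^bsub>L\<^esub> y) = down L x \<inter> down L y"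
    using assms(2,3) meet_left[of x y] meet_right[of x y]
    by (auto simp: down_def intro: meet_le le_trans[OF _ meet_left] le_trans[OF _ meet_right])
  then show ?thesis using that[of "x \<sqinter>\<^bsub>L\<^esub> y"] assms(2,3) by simp
qed

locale lattice_family =
  fixes I :: "'i set" and L :: "'i \<Rightarrow> 'a gorder"
  assumes finite_index: "finite I"
    and finite_lattice: "i \<in> I \<Longrightarrow> finite_lattice (L i)"
    and nontrivial: "i \<in> I \<Longrightarrow> card (carrier (L i)) \<ge> 2"
    and two_members: "\<exists>i\<in>I. \<exists>j\<in>I. i \<noteq> j"
begin

text \<open>
  The parachute is realised as a family of sets of pairs, ordered by inclusion. The copy of \<open>L\<^sub>i\<close>
  consists of the principal ideals of \<open>L\<^sub>i\<close>, tagged with \<open>i\<close>, except that the greatest element of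
  every \<open>L\<^sub>i\<close> is sent to the disjoint union of all carriers, the canopy. This glues the copies at
  the top. The new bottom element is the empty set.
\<close>

definition canopy :: "('i \<times> 'a) set" where
  "canopy = (SIGMA i:I. carrier (L i))"

definition node :: "'i \<Rightarrow> 'a \<Rightarrow> ('i \<times> 'a) set" where
  "node i x = (if down (L i) x = carrier (L i) then canopy else {i} \<times> down (L i) x)"

definition parachute :: "('i \<times> 'a) set set" where
  "parachute = insert {} (\<Union>i\<in>I. node i ` carrier (L i))"

lemma lattice: "i \<in> I \<Longrightarrow> lattice (L i)"
  and finite_carrier: "i \<in> I \<Longrightarrow> finite (carrier (L i))"
  and carrier_nonempty: "i \<in> I \<Longrightarrow> carrier (L i) \<noteq> {}"
  using finite_lattice by (auto simp: finite_lattice_def)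

lemma self_in_down: "i \<in> I \<Longrightarrow> x \<in> carrier (L i) \<Longrightarrow> x \<in> down (L i) x"
  using lattice[of i] by (simp add: down_def lattice_def upper_semilattice_def partial_order_def
      weak_partial_order.le_refl)

lemma node_nonempty: "i \<in> I \<Longrightarrow> x \<in> carrier (L i) \<Longrightarrow> node i x \<noteq> {}"
  using self_in_down carrier_nonempty unfolding node_def canopy_def by auto

lemma node_subset_canopy: "i \<in> I \<Longrightarrow> node i x \<subseteq> canopy"
  by (auto simp: node_def canopy_def down_def)

text \<open>
  A second lattice of the family contributes elements with another tag. So no tagged ideal reaches
  above the canopy, which keeps the top element apart from all others.
\<close>

lemma canopy_not_subset_strand: "\<not> canopy \<subseteq> {i} \<times> A"
proof
  assume sub: "canopy \<subseteq> {i} \<times> A"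
  obtain j where "j \<in> I" "j \<noteq> i" using two_members by metis
  then show False using sub carrier_nonempty[of j] by (auto simp: canopy_def)
qed

lemma node_eq_canopy_iff: "node i x = canopy \<longleftrightarrow> down (L i) x = carrier (L i)"
  using canopy_not_subset_strand[of i] by (auto simp: node_def)

lemma node_subset_iff:
  assumes "i \<in> I" "x \<in> carrier (L i)" "y \<in> carrier (L i)"
  shows "node i x \<subseteq> node i y \<longleftrightarrow> x \<sqsubseteq>\<^bsub>L i\<^esub> y"
proof (cases "down (L i) y = carrier (L i)")
  case True
  then have "x \<sqsubseteq>\<^bsub>L i\<^esub> y" using assms by (auto simp: down_def)
  then show ?thesis using True assms node_subset_canopy by (simp add: node_def)
next
  case False
  have "down (L i) y \<subseteq> carrier (L i)" by (auto simp: down_def)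
  then have "node i x \<subseteq> node i y \<longleftrightarrow> down (L i) x \<subseteq> down (L i) y"
    using False canopy_not_subset_strand[of i] by (auto simp: node_def)
  then show ?thesis using down_subset_iff[OF lattice] assms by simp
qed

lemma node_inj:
  assumes "i \<in> I" "x \<in> carrier (L i)" "y \<in> carrier (L i)" "node i x = node i y"
  shows "x = y"
proof -
  interpret lattice "L i" using lattice assms(1) .
  show ?thesis using assms node_subset_iff[of i x y] node_subset_iff[of i y x]
    by (simp add: le_antisym)
qed

lemma node_disjoint:
  assumes "i \<noteq> j" "node i x \<noteq> canopy" "node j y \<noteq> canopy"
  shows "node i x \<inter> node j y = {}"
  using assms by (auto simp: node_def split: if_splits)

lemma node_in_parachute: "i \<in> I \<Longrightarrow> x \<in> carrier (L i) \<Longrightarrow> node i x \<in> parachute"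
  by (auto simp: parachute_def)

lemma canopy_eq_node:
  assumes "i \<in> I"
  obtains t where "t \<in> carrier (L i)" "canopy = node i t"
proof -
  obtain t where t: "t \<in> carrier (L i)" "\<And>x. x \<in> carrier (L i) \<Longrightarrow> x \<sqsubseteq>\<^bsub>L i\<^esub> t"
    using finite_lattice_bounds[OF finite_lattice[OF assms]] by metis
  then have "down (L i) t = carrier (L i)" by (auto simp: down_def)
  then show ?thesis using that t node_eq_canopy_iff by metis
qed

lemma canopy_in_parachute: "canopy \<in> parachute"
  using canopy_eq_node node_in_parachute two_members by metis

lemma parachute_subset_canopy: "A \<in> parachute \<Longrightarrow> A \<subseteq> canopy"
  using node_subset_canopy by (auto simp: parachute_def)

lemma node_proper:
  assumes "i \<in> I" "x \<in> carrier (L i)" "y \<in> carrier (L i)" "x \<noteq> y" "x \<sqsubseteq>\<^bsub>L i\<^esub> y"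
  shows "node i x \<noteq> canopy"
proof
  assume "node i x = canopy"
  then have "node i y \<subseteq> node i x" using node_subset_canopy assms(1) by simp
  then show False using assms node_subset_iff[of i x y] node_inj[of i x y] by auto
qed

lemma bottom_node:
  assumes i: "i \<in> I"
  obtains b where "b \<in> carrier (L i)" "\<And>z. z \<in> carrier (L i) \<Longrightarrow> b \<sqsubseteq>\<^bsub>L i\<^esub> z" "node i b \<noteq> canopy"
proof -
  obtain b where b: "b \<in> carrier (L i)" "\<And>z. z \<in> carrier (L i) \<Longrightarrow> b \<sqsubseteq>\<^bsub>L i\<^esub> z"
    using finite_lattice_bounds[OF finite_lattice[OF i]] by metis
  have "\<not> carrier (L i) \<subseteq> {b}" using nontrivial[OF i] card_mono[of "{b}" "carrier (L i)"] by force
  then obtain z where "z \<in> carrier (L i)" "z \<noteq> b" by blast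
  then have "node i b \<noteq> canopy" using node_proper[OF i b(1)] b(2) by metis
  then show ?thesis using that b by blast
qed

lemma parachute_cases:
  assumes "A \<in> parachute"
  obtains "A = {}" | "A = canopy" | i x where "i \<in> I" "x \<in> carrier (L i)" "A = node i x" "A \<noteq> canopy"
  using assms unfolding parachute_def by blast

text \<open>
  Different copies share only the canopy, so the part of the parachute above a node of the copy of
  \<open>L\<^sub>i\<close> never leaves that copy. Taking the lowest node, this identifies an upper interval of the
  parachute with \<open>L\<^sub>i\<close>; it also shows that nodes of different copies have the canopy as join.
\<close>

lemma parachute_above_node:
  assumes "i \<in> I" "x \<in> carrier (L i)" "A \<in> parachute" "node i x \<subseteq> A"
  shows "A \<in> node i ` carrier (L i)"
  using assms(3)
proof (cases rule: parachute_cases)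
  case 1
  then show ?thesis using assms node_nonempty by auto
next
  case 2
  then show ?thesis using canopy_eq_node[OF assms(1)] by auto
next
  case (3 j y)
  have "node i x \<noteq> canopy" using 3 assms(1,4) node_subset_canopy[of j y] by auto
  then have "i = j" using node_disjoint[of i j x y] 3 assms node_nonempty by blast
  then show ?thesis using 3 by auto
qed

lemma parachute_Int:
  assumes "A \<in> parachute" "B \<in> parachute"
  shows "A \<inter> B \<in> parachute"
proof (cases "A = {} \<or> A = canopy \<or> B = {} \<or> B = canopy")
  case True
  then show ?thesis
    using assms parachute_subset_canopy[of A] parachute_subset_canopy[of B]
    by (auto simp: Int_absorb1 Int_absorb2 parachute_def[THEN eqset_imp_iff, of "{}"])
next
  case False
  obtain i x where A: "i \<in> I" "x \<in> carrier (L i)" "A = node i x" "A \<noteq> canopy"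
    using parachute_cases[OF assms(1)] False by metis
  obtain j y where B: "j \<in> I" "y \<in> carrier (L j)" "B = node j y" "B \<noteq> canopy"
    using parachute_cases[OF assms(2)] False by metis
  show ?thesis
  proof (cases "i = j")
    case True
    obtain z where z: "z \<in> carrier (L i)" "down (L i) z = down (L i) x \<inter> down (L i) y"
      using down_meet[OF lattice[OF A(1)] A(2)] B(2) True by metis
    have d: "down (L i) x \<noteq> carrier (L i)" "down (L i) y \<noteq> carrier (L i)"
      using A B True node_eq_canopy_iff by auto
    then have "down (L i) z \<noteq> carrier (L i)"
      using z(2) by (auto simp: down_def)
    then have "A \<inter> B = node i z"
      using d z(2) A(3) B(3) True by (auto simp: node_def)
    then show ?thesis using node_in_parachute[OF A(1) z(1)] by simp
  next
    case False
    then show ?thesis using node_disjoint A B by (simp add: parachute_def)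
  qed
qed

lemma finite_lattice_parachute: "finite_lattice (family_order parachute)"
  by (rule finite_lattice_intersection_family[of _ canopy])
    (auto simp: parachute_subset_canopy[THEN subsetD] canopy_in_parachute parachute_Int,
     simp add: parachute_def finite_index finite_carrier)

end
section \<open>Core-free subgroups and images of intervals\<close>

lemma core_free_iff:
  assumes "group G" "subgroup H G"
  shows "core_free G H \<longleftrightarrow> (\<forall>N. N \<lhd> G \<and> N \<subseteq> H \<longrightarrow> N = {\<one>\<^bsub>G\<^esub>})"
proof
  assume cf: "core_free G H"
  show "\<forall>N. N \<lhd> G \<and> N \<subseteq> H \<longrightarrow> N = {\<one>\<^bsub>G\<^esub>}"
  proof (intro allI impI)
    fix N assume N: "N \<lhd> G \<and> N \<subseteq> H"
    then have "N \<subseteq> {\<one>\<^bsub>G\<^esub>}"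
      using core_greatest(3)[OF assms, of N] cf by (simp add: core_free_def)
    moreover have "\<one>\<^bsub>G\<^esub> \<in> N"
      using N by (simp add: normal_imp_subgroup subgroup.one_closed)
    ultimately show "N = {\<one>\<^bsub>G\<^esub>}" by auto
  qed
next
  assume "\<forall>N. N \<lhd> G \<and> N \<subseteq> H \<longrightarrow> N = {\<one>\<^bsub>G\<^esub>}"
  then show "core_free G H"
    using core_greatest(1,2)[OF assms] by (simp add: core_free_def)
qed

text \<open>
  The correspondence theorem: a surjective homomorphism matches the subgroups above a subgroup
  containing its kernel with the subgroups above the image.
\<close>

context group_hom
begin

lemma subgroup_preimage:
  assumes "subgroup K H"
  shows "subgroup {x \<in> carrier G. h x \<in> K} G"
  using assms by unfold_locales
    (auto simp: subgroup.m_closed subgroup.one_closed subgroup.m_inv_closed)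

lemma normal_preimage:
  assumes "N \<lhd> H"
  shows "{x \<in> carrier G. h x \<in> N} \<lhd> G"
  unfolding G.normal_inv_iff
  using subgroup_preimage[OF normal_imp_subgroup[OF assms]] normal.inv_op_closed2[OF assms]
  by auto

lemma image_subset_iff_of_kernel:
  assumes "subgroup A G" "subgroup B G" "kernel G H h \<subseteq> B"
  shows "h ` A \<subseteq> h ` B \<longleftrightarrow> A \<subseteq> B"
proof
  assume im: "h ` A \<subseteq> h ` B"
  show "A \<subseteq> B"
  proof
    fix a assume a: "a \<in> A"
    then obtain b where b: "b \<in> B" "h a = h b" using im by blast
    have car: "a \<in> carrier G" "b \<in> carrier G"
      using a b assms subgroup.mem_carrier by fast+
    then have "h (a \<otimes> inv b) = \<one>\<^bsub>H\<^esub>"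
      using b(2) by (simp add: H.r_inv)
    then have "a \<otimes> inv b \<in> B"
      using car assms(3) by (auto simp: kernel_def)
    then have "a \<otimes> inv b \<otimes> b \<in> B"
      using b(1) assms(2) by (simp add: subgroup.m_closed)
    then show "a \<in> B" using car by (simp add: G.m_assoc)
  qed
qed auto

lemma subgroup_interval_image:
  assumes surj: "h ` carrier G = carrier H" and K: "subgroup K G" and ker: "kernel G H h \<subseteq> K"
  shows "lattice_isomorphic (subgroup_interval G K) (subgroup_interval H (h ` K))"
proof -
  let ?C = "{A. subgroup A G \<and> K \<subseteq> A}" and ?D = "{B. subgroup B H \<and> h ` K \<subseteq> B}"
  have le: "A \<subseteq> B \<longleftrightarrow> h ` A \<subseteq> h ` B" if "A \<in> ?C" "B \<in> ?C" for A B
    using that ker image_subset_iff_of_kernel[of A B] by auto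
  have "(`) h ` ?C = ?D"
  proof
    show "(`) h ` ?C \<subseteq> ?D" by (auto simp: subgroup_img_is_subgroup)
    show "?D \<subseteq> (`) h ` ?C"
    proof
      fix B assume B: "B \<in> ?D"
      let ?A = "{x \<in> carrier G. h x \<in> B}"
      have "?A \<in> ?C"
        using B subgroup_preimage[of B] subgroup.subset[OF K] by auto
      moreover have "h ` ?A = B"
        using subset_trans[OF subgroup.subset[of B H] equalityD2[OF surj]] B by auto
      ultimately show "B \<in> (`) h ` ?C" by blast
    qed
  qed
  moreover have "inj_on ((`) h) ?C"
  proof (rule inj_onI)
    fix A B assume "A \<in> ?C" "B \<in> ?C" "h ` A = h ` B"
    then show "A = B" using le[of A B] le[of B A] by simp
  qed
  ultimately have "bij_betw ((`) h) ?C ?D" by (simp add: bij_betw_def)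
  then show ?thesis
    unfolding lattice_isomorphic_def subgroup_interval_def
    by (intro exI[of _ "(`) h"]) (use le in simp)
qed

end

text \<open>
  The quotient by the core of \<open>H\<close> is realised by numbering its cosets. A normal subgroup of the
  quotient inside the image of \<open>H\<close> pulls back to a normal subgroup inside \<open>H\<close>, hence inside the
  core, and so is trivial.
\<close>

lemma core_free_nat_quotient:
  fixes G :: "'g monoid" (structure)
  assumes fin: "finite_group G" and H: "subgroup H G"
  obtains G' :: "nat monoid" and H' where "finite_group G'" "subgroup H' G'" "core_free G' H'"
    "lattice_isomorphic (subgroup_interval G H) (subgroup_interval G' H')"
proof -
  interpret group G using fin by (simp add: finite_group_def)
  define N where "N = core G H"
  interpret N: normal N G
    using core_greatest(1)[OF is_group H] by (simp add: N_def)
  have finG: "finite (carrier G)" using fin by (simp add: finite_group_def)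
  then have "finite ((\<lambda>a. N #> a) ` carrier G)" by simp
  then obtain c :: "'g set \<Rightarrow> nat" where c: "inj_on c ((\<lambda>a. N #> a) ` carrier G)"
    using finite_imp_inj_to_nat_seg by metis
  define f where "f a = c (N #> a)" for a
  have weak: "weak_group_morphism f N G"
  proof (rule weak_group_morphismsI[OF N.normal_axioms])
    fix a b assume ab: "a \<in> carrier G" "b \<in> carrier G"
    have "f a = f b \<longleftrightarrow> N #> a = N #> b"
      using c ab unfolding f_def by (auto dest: inj_onD)
    also have "\<dots> \<longleftrightarrow> a \<in> N #> b"
      using rcos_self[OF ab(1) N.subgroup_axioms] repr_independence[OF _ ab(2) N.subgroup_axioms]
      by auto
    also have "\<dots> \<longleftrightarrow> a \<otimes> inv b \<in> N"
      using N.rcos_module[OF is_group ab(2,1)] .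
    finally show "f a = f b \<longleftrightarrow> a \<otimes> inv b \<in> N" .
  qed
  let ?G = "image_group f G"
  interpret f: group_hom G ?G f
    using weak_group_morphism_group_hom[OF weak] .
  have ker: "kernel G ?G f = N" using weak_group_morphism_ker[OF weak] .
  have surj: "f ` carrier G = carrier ?G" by (simp add: image_group_carrier)
  have NH: "N \<subseteq> H" using core_greatest(2)[OF is_group H] by (simp add: N_def)
  have sub: "subgroup (f ` H) ?G" using f.subgroup_img_is_subgroup[OF H] .
  have "M = {\<one>\<^bsub>?G\<^esub>}" if M: "M \<lhd> ?G" "M \<subseteq> f ` H" for M
  proof -
    let ?P = "{x \<in> carrier G. f x \<in> M}"
    have fP: "f ` ?P = M"
      using subset_trans[OF subgroup.subset[OF normal_imp_subgroup[OF M(1)]] equalityD2[OF surj]]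
      by auto
    have P: "?P \<lhd> G" using f.normal_preimage[OF M(1)] .
    have "?P \<subseteq> H"
      using f.image_subset_iff_of_kernel[OF normal_imp_subgroup[OF P] H] fP M(2) ker NH by simp
    then have "?P \<subseteq> N" using core_greatest(3)[OF is_group H P] by (simp add: N_def)
    then have "f ` ?P \<subseteq> f ` N" by (rule image_mono)
    also have "f ` N \<subseteq> {\<one>\<^bsub>?G\<^esub>}" unfolding ker[symmetric] by (auto simp: kernel_def)
    finally have "M \<subseteq> {\<one>\<^bsub>?G\<^esub>}" unfolding fP .
    moreover have "\<one>\<^bsub>?G\<^esub> \<in> M" using M(1) by (simp add: normal_imp_subgroup subgroup.one_closed)
    ultimately show ?thesis by auto
  qed
  then have "core_free ?G (f ` H)" by (simp add: core_free_iff[OF f.H.is_group sub])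
  moreover have "finite_group ?G"
    unfolding finite_group_def surj[symmetric] using finG f.H.is_group by simp
  moreover have "lattice_isomorphic (subgroup_interval G H) (subgroup_interval ?G (f ` H))"
    using f.subgroup_interval_image[OF surj H] ker NH by simp
  ultimately show ?thesis using that[OF _ sub] by simp
qed

section \<open>Groups with a parachute interval\<close>

context group
begin

lemma normal_set_mult_subgroup:
  assumes "N \<lhd> G" "subgroup H G"
  shows "subgroup (N <#> H) G"
  using assms second_isomorphism_grp.normal_set_mult_subgroup
  unfolding second_isomorphism_grp_def second_isomorphism_grp_axioms_def by blast

lemma subset_set_mult_left: "N \<subseteq> carrier G \<Longrightarrow> subgroup H G \<Longrightarrow> N \<subseteq> N <#> H"
  unfolding set_mult_def using subgroup.one_closed r_one by force

lemma subset_set_mult_right: "subgroup N G \<Longrightarrow> H \<subseteq> carrier G \<Longrightarrow> H \<subseteq> N <#> H"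
  unfolding set_mult_def using subgroup.one_closed l_one by force

text \<open>
  A form of the Dedekind law \<open>Y' \<inter> N Y = (Y' \<inter> N) Y\<close> for \<open>Y \<subseteq> Y'\<close>: the factor from \<open>N\<close> in a factorisation of
  an element of \<open>Y'\<close> lies in \<open>Y'\<close> as well.
\<close>

lemma eq_of_set_mult_eq_carrier:
  assumes Y: "subgroup Y G" and Y': "subgroup Y' G" and le: "Y \<subseteq> Y'"
    and N: "N \<subseteq> carrier G" and full: "N <#> Y = carrier G" and small: "N \<inter> Y' \<subseteq> Y"
  shows "Y' = Y"
proof
  show "Y' \<subseteq> Y"
  proof
    fix y' assume y': "y' \<in> Y'"
    then have "y' \<in> N <#> Y" using full Y' subgroup.mem_carrier by fast
    then obtain m y where my: "m \<in> N" "y \<in> Y" "y' = m \<otimes> y" by (auto simp: set_mult_def)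
    have car: "m \<in> carrier G" "y \<in> carrier G"
      using my N subgroup.mem_carrier[OF Y] by auto
    have "m = y' \<otimes> inv y" using my car by (simp add: m_assoc)
    then have "m \<in> Y'" using y' my(2) le Y' by (auto simp: subgroup.m_closed subgroup.m_inv_closed)
    then have "m \<in> Y" using my small by blast
    then show "y' \<in> Y" using my Y by (simp add: subgroup.m_closed)
  qed
qed (rule le)

end

locale parachute_interval = lattice_family I L + group G
  for I :: "'i set" and L :: "'i \<Rightarrow> 'a gorder" and G :: "('g, 'm) monoid_scheme" (structure) +
  fixes H and \<phi>
  assumes two_large: "\<exists>i\<in>I. \<exists>j\<in>I. i \<noteq> j \<and> card (carrier (L i)) > 2 \<and> card (carrier (L j)) > 2"
    and subgroup_H: "subgroup H G"
    and core_free_H: "core_free G H"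
    and bij_\<phi>: "bij_betw \<phi> parachute {K. subgroup K G \<and> H \<subseteq> K}"
    and subset_iff_\<phi>: "A \<in> parachute \<Longrightarrow> B \<in> parachute \<Longrightarrow> A \<subseteq> B \<longleftrightarrow> \<phi> A \<subseteq> \<phi> B"
begin

lemma interval_eq_\<phi>:
  assumes "subgroup K G" "H \<subseteq> K"
  obtains A where "A \<in> parachute" "K = \<phi> A"
  using bij_betw_imp_surj_on[OF bij_\<phi>] assms by blast

lemma \<phi>_interval: "A \<in> parachute \<Longrightarrow> subgroup (\<phi> A) G" "A \<in> parachute \<Longrightarrow> H \<subseteq> \<phi> A"
  using bij_betwE[OF bij_\<phi>] by blast+

lemma \<phi>_inj: "A \<in> parachute \<Longrightarrow> B \<in> parachute \<Longrightarrow> \<phi> A = \<phi> B \<Longrightarrow> A = B"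
  using bij_betw_imp_inj_on[OF bij_\<phi>] by (simp add: inj_on_eq_iff)

lemma \<phi>_empty: "\<phi> {} = H"
proof -
  obtain A where A: "A \<in> parachute" "H = \<phi> A" using interval_eq_\<phi>[OF subgroup_H] by blast
  have e: "{} \<in> parachute" by (simp add: parachute_def)
  then have "\<phi> {} \<subseteq> H" using A subset_iff_\<phi>[of "{}" A] by simp
  then show ?thesis using \<phi>_interval(2)[OF e] by simp
qed

lemma \<phi>_canopy: "\<phi> canopy = carrier G"
proof -
  obtain A where A: "A \<in> parachute" "carrier G = \<phi> A"
    using interval_eq_\<phi>[OF subgroup_self subgroup.subset[OF subgroup_H]] by blast
  then have "carrier G \<subseteq> \<phi> canopy"
    using subset_iff_\<phi>[OF A(1) canopy_in_parachute] parachute_subset_canopy by simp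
  then show ?thesis using \<phi>_interval(1)[OF canopy_in_parachute] subgroup.subset by blast
qed

lemma \<phi>_node_Int:
  assumes ij: "i \<in> I" "j \<in> I" "i \<noteq> j" and x: "x \<in> carrier (L i)" and y: "y \<in> carrier (L j)"
    and proper: "node i x \<noteq> canopy" "node j y \<noteq> canopy"
  shows "\<phi> (node i x) \<inter> \<phi> (node j y) = H"
proof -
  note nodes = node_in_parachute[OF ij(1) x] node_in_parachute[OF ij(2) y]
  obtain A where A: "A \<in> parachute" "\<phi> (node i x) \<inter> \<phi> (node j y) = \<phi> A"
    using interval_eq_\<phi>[OF subgroups_Inter_pair] \<phi>_interval nodes by (metis le_infI)
  then have "\<phi> A \<subseteq> \<phi> (node i x)" "\<phi> A \<subseteq> \<phi> (node j y)" by blast+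
  then have "A \<subseteq> node i x \<inter> node j y"
    using subset_iff_\<phi>[OF A(1)] nodes by simp
  then show ?thesis using A \<phi>_empty node_disjoint[OF ij(3) proper] by simp
qed

lemma \<phi>_node_join:
  assumes ij: "i \<in> I" "j \<in> I" "i \<noteq> j" and x: "x \<in> carrier (L i)" and y: "y \<in> carrier (L j)"
    and K: "subgroup K G" "\<phi> (node i x) \<subseteq> K" "\<phi> (node j y) \<subseteq> K"
  shows "K = carrier G"
proof -
  note nodes = node_in_parachute[OF ij(1) x] node_in_parachute[OF ij(2) y]
  have "H \<subseteq> K" using K(2) \<phi>_interval(2) nodes by blast
  then obtain A where A: "A \<in> parachute" "K = \<phi> A" using interval_eq_\<phi> K(1) by metis
  then have sub: "node i x \<subseteq> A" "node j y \<subseteq> A" using K nodes subset_iff_\<phi> by auto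
  have "A = canopy"
  proof (rule ccontr)
    assume "A \<noteq> canopy"
    moreover obtain u v where "u \<in> carrier (L i)" "A = node i u" "v \<in> carrier (L j)" "A = node j v"
      using parachute_above_node[OF ij(1) x A(1) sub(1)] parachute_above_node[OF ij(2) y A(1) sub(2)]
      by blast
    ultimately show False
      using node_disjoint[OF ij(3), of u v] node_nonempty[OF ij(1)] by (metis Int_absorb)
  qed
  then show ?thesis using A \<phi>_canopy by simp
qed

text \<open>
  The heart of the matter. If \<open>N H\<close> were a proper subgroup in the copy of \<open>L\<^sub>i\<close>, a chain
  \<open>Y < Y' < G\<close> in the copy of another large \<open>L\<^sub>j\<close> would violate the Dedekind law.
\<close>

lemma normal_set_mult_eq_carrier:
  assumes N: "N \<lhd> G" and ne: "N \<noteq> {\<one>}"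
  shows "N <#> H = carrier G"
proof (rule ccontr)
  assume proper: "N <#> H \<noteq> carrier G"
  have Nsub: "subgroup N G" using N by (rule normal_imp_subgroup)
  then have Ncar: "N \<subseteq> carrier G" by (rule subgroup.subset)
  have NNH: "N \<subseteq> N <#> H" using subset_set_mult_left[OF Ncar subgroup_H] .
  have HNH: "H \<subseteq> N <#> H"
    using subset_set_mult_right[OF Nsub subgroup.subset[OF subgroup_H]] .
  obtain A where A: "A \<in> parachute" "N <#> H = \<phi> A"
    using interval_eq_\<phi>[OF normal_set_mult_subgroup[OF N subgroup_H] HNH] .
  have "\<not> N \<subseteq> H" using core_free_H core_free_iff[OF is_group subgroup_H] N ne by blast
  then have "A \<noteq> {}" using A NNH \<phi>_empty by auto
  moreover have "A \<noteq> canopy" using A proper \<phi>_canopy by auto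
  ultimately obtain i x where ix: "i \<in> I" "x \<in> carrier (L i)" "A = node i x" "A \<noteq> canopy"
    using parachute_cases[OF A(1)] by metis
  obtain j where j: "j \<in> I" "j \<noteq> i" "card (carrier (L j)) > 2"
    using two_large by metis
  obtain b t where b: "b \<in> carrier (L j)" "\<And>z. z \<in> carrier (L j) \<Longrightarrow> b \<sqsubseteq>\<^bsub>L j\<^esub> z"
    and t: "t \<in> carrier (L j)" "\<And>z. z \<in> carrier (L j) \<Longrightarrow> z \<sqsubseteq>\<^bsub>L j\<^esub> t"
    using finite_lattice_bounds[OF finite_lattice[OF j(1)]] by metis
  \<comment> \<open>A third element \<open>m\<close> yields the chain: \<open>Y\<close> from the bottom \<open>b\<close>, \<open>Y'\<close> from \<open>m\<close>, which lies below the top \<open>t\<close>.\<close>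
  have "card {b, t} \<le> 2" by (simp add: card_insert_if)
  then have "\<not> carrier (L j) \<subseteq> {b, t}" using j(3) card_mono[of "{b, t}" "carrier (L j)"] by force
  then obtain m where m: "m \<in> carrier (L j)" "m \<noteq> b" "m \<noteq> t" by blast
  have m_proper: "node j m \<noteq> canopy" using node_proper[OF j(1) m(1) t(1) m(3)] t(2) m(1) by blast
  note nodes = node_in_parachute[OF j(1) b(1)] node_in_parachute[OF j(1) m(1)]
  let ?Y = "\<phi> (node j b)" and ?Y' = "\<phi> (node j m)"
  have Y: "subgroup ?Y G" "H \<subseteq> ?Y" "subgroup ?Y' G" using \<phi>_interval nodes by auto
  have le: "?Y \<subseteq> ?Y'"
    using subset_iff_\<phi>[OF nodes] node_subset_iff[OF j(1) b(1) m(1)] b(2) m(1) by blast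
  have NY: "subgroup (N <#> ?Y) G" using normal_set_mult_subgroup[OF N Y(1)] .
  have "\<phi> (node i x) \<subseteq> N <#> ?Y"
    unfolding ix(3)[symmetric] A(2)[symmetric] by (rule mono_set_mult[OF order_refl Y(2)])
  moreover have "?Y \<subseteq> N <#> ?Y" using subset_set_mult_right[OF Nsub subgroup.subset[OF Y(1)]] .
  ultimately have full: "N <#> ?Y = carrier G"
    using \<phi>_node_join[OF ix(1) j(1) j(2)[symmetric] ix(2) b(1) NY] by simp
  have "(N <#> H) \<inter> ?Y' = H"
    using \<phi>_node_Int[OF ix(1) j(1) j(2)[symmetric] ix(2) m(1)] ix m_proper A(2) by simp
  then have "N \<inter> ?Y' \<subseteq> ?Y" using NNH Y(2) by blast
  then have "?Y' = ?Y" using eq_of_set_mult_eq_carrier[OF Y(1,3) le Ncar full] by simp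
  then show False using \<phi>_inj[OF nodes(2,1)] node_inj[OF j(1) m(1) b(1)] m(2) by simp
qed

text \<open>A nontrivial normal subgroup \<open>N\<close> inside \<open>Y\<close> would give \<open>G = N H \<subseteq> Y\<close>.\<close>

lemma core_free_of_proper:
  assumes "subgroup Y G" "H \<subseteq> Y" "Y \<subset> carrier G"
  shows "core_free G Y"
  unfolding core_free_iff[OF is_group assms(1)]
proof (intro allI impI)
  fix N assume N: "N \<lhd> G \<and> N \<subseteq> Y"
  show "N = {\<one>}"
  proof (rule ccontr)
    assume "N \<noteq> {\<one>}"
    then have "carrier G = N <#> H" using N normal_set_mult_eq_carrier by simp
    also have "\<dots> \<subseteq> Y <#> Y" using N assms(2) by (simp add: mono_set_mult)
    also have "\<dots> = Y" using subgroup_mult_id[OF assms(1)] .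
    finally show False using assms(3) by blast
  qed
qed

lemma upper_interval:
  assumes i: "i \<in> I"
  obtains K where "subgroup K G" "H \<subseteq> K" "K \<subset> carrier G"
    "lattice_isomorphic (L i) (subgroup_interval G K)"
proof -
  obtain b where b: "b \<in> carrier (L i)" "\<And>z. z \<in> carrier (L i) \<Longrightarrow> b \<sqsubseteq>\<^bsub>L i\<^esub> z"
    and proper: "node i b \<noteq> canopy"
    using bottom_node[OF i] by metis
  note node = node_in_parachute[OF i]
  let ?K = "\<phi> (node i b)"
  have K: "subgroup ?K G" "H \<subseteq> ?K" using \<phi>_interval node[OF b(1)] by auto
  have "?K \<noteq> carrier G"
    using proper \<phi>_canopy \<phi>_inj[OF node[OF b(1)] canopy_in_parachute] by metis
  then have "?K \<subset> carrier G" using subgroup.subset[OF K(1)] by blast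
  moreover have "lattice_isomorphic (L i) (subgroup_interval G ?K)"
  proof -
    let ?f = "\<lambda>x. \<phi> (node i x)"
    have le: "x \<sqsubseteq>\<^bsub>L i\<^esub> y \<longleftrightarrow> ?f x \<subseteq> ?f y" if "x \<in> carrier (L i)" "y \<in> carrier (L i)" for x y
      using subset_iff_\<phi>[OF node[OF that(1)] node[OF that(2)]] node_subset_iff[OF i that] by simp
    have "inj_on ?f (carrier (L i))"
      by (rule inj_onI) (metis \<phi>_inj node node_inj i)
    moreover have "?f ` carrier (L i) = {K. subgroup K G \<and> ?K \<subseteq> K}"
    proof
      show "?f ` carrier (L i) \<subseteq> {K. subgroup K G \<and> ?K \<subseteq> K}"
        using \<phi>_interval(1)[OF node] le[OF b(1)] b(2) by auto
      show "{K. subgroup K G \<and> ?K \<subseteq> K} \<subseteq> ?f ` carrier (L i)"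
      proof
        fix K assume "K \<in> {K. subgroup K G \<and> ?K \<subseteq> K}"
        then have KK: "subgroup K G" "?K \<subseteq> K" by auto
        then obtain A where A: "A \<in> parachute" "K = \<phi> A" using interval_eq_\<phi> K(2) by (metis order_trans)
        then have "node i b \<subseteq> A" using subset_iff_\<phi>[OF node[OF b(1)]] KK(2) by simp
        then show "K \<in> ?f ` carrier (L i)"
          using parachute_above_node[OF i b(1) A(1)] A(2) by blast
      qed
    qed
    ultimately have "bij_betw ?f (carrier (L i)) {K. subgroup K G \<and> ?K \<subseteq> K}"
      by (simp add: bij_betw_def)
    then show ?thesis
      unfolding lattice_isomorphic_def subgroup_interval_def
      by (intro exI[of _ ?f]) (use le in simp)
  qed
  ultimately show ?thesis using that K by blast
qed

end

section \<open>The equivalence\<close>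

definition every_finite_lattice_is_interval :: bool where
  "every_finite_lattice_is_interval \<longleftrightarrow>
     (\<forall>L :: nat gorder. finite_lattice L \<longrightarrow>
        (\<exists>(G :: nat monoid) H. finite_group G \<and> subgroup H G \<and>
           lattice_isomorphic L (subgroup_interval G H)))"

definition jointly_interval_representable ::
    "nat \<Rightarrow> (nat \<Rightarrow> nat gorder) \<Rightarrow> (nat \<Rightarrow> nat monoid set) \<Rightarrow> bool" where
  "jointly_interval_representable n L \<XX> \<longleftrightarrow>
     (\<exists>G. finite_group G \<and> G \<in> (\<Inter>i\<in>{1..n}. \<XX> i) \<and>
        (\<forall>i\<in>{1..n}. \<exists>H. subgroup H G \<and>
           lattice_isomorphic (L i) (subgroup_interval G H) \<and>
           (\<forall>Y. subgroup Y G \<and> H \<subseteq> Y \<and> Y \<subset> carrier G \<longrightarrow> core_free G Y)))"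

lemma jointly_interval_representable_if:
  fixes L :: "nat \<Rightarrow> nat gorder"
  assumes B: every_finite_lattice_is_interval
    and lat: "\<forall>i\<in>{1..n}. finite_lattice (L i) \<and> card (carrier (L i)) \<ge> 2"
    and large: "\<exists>i\<in>{1..n}. \<exists>j\<in>{1..n}. i \<noteq> j \<and> card (carrier (L i)) > 2 \<and> card (carrier (L j)) > 2"
    and enf: "\<forall>i\<in>{1..n}. cf_interval_enforceable (\<XX> i) (L i)"
  shows "jointly_interval_representable n L \<XX>"
proof -
  interpret lattice_family "{1..n}" L
    by unfold_locales (use lat large in blast)+
  obtain M :: "nat gorder" where M: "finite_lattice M" "lattice_isomorphic (family_order parachute) M"
    using finite_lattice_nat_copy[OF finite_lattice_parachute] .
  obtain G0 :: "nat monoid" and H0 where GH0: "finite_group G0" "subgroup H0 G0"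
    "lattice_isomorphic M (subgroup_interval G0 H0)"
    using B M(1) unfolding every_finite_lattice_is_interval_def by blast
  obtain G :: "nat monoid" and H where GH: "finite_group G" "subgroup H G" "core_free G H"
    "lattice_isomorphic (subgroup_interval G0 H0) (subgroup_interval G H)"
    using core_free_nat_quotient[OF GH0(1,2)] .
  have "lattice_isomorphic (family_order parachute) (subgroup_interval G H)"
    using lattice_isomorphic_trans[OF lattice_isomorphic_trans[OF M(2) GH0(3)] GH(4)] .
  then obtain \<phi> where \<phi>: "bij_betw \<phi> parachute {K. subgroup K G \<and> H \<subseteq> K}"
    "\<forall>A\<in>parachute. \<forall>B\<in>parachute. A \<subseteq> B \<longleftrightarrow> \<phi> A \<subseteq> \<phi> B"
    unfolding lattice_isomorphic_def by (auto simp: family_order_def subgroup_interval_def)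
  interpret group G using GH(1) by (simp add: finite_group_def)
  interpret parachute_interval "{1..n}" L G H \<phi>
    by (intro parachute_interval.intro parachute_interval_axioms.intro)
      (fact lattice_family_axioms, fact is_group, fact large, fact GH(2), fact GH(3), fact \<phi>(1),
       simp add: \<phi>(2))
  have ex: "\<exists>K. subgroup K G \<and> lattice_isomorphic (L i) (subgroup_interval G K) \<and> core_free G K \<and>
      (\<forall>Y. subgroup Y G \<and> K \<subseteq> Y \<and> Y \<subset> carrier G \<longrightarrow> core_free G Y)"
    if "i \<in> {1..n}" for i
    using upper_interval[OF that] core_free_of_proper by (metis order_trans)
  then have "G \<in> \<XX> i" if "i \<in> {1..n}" for i
    using that enf GH(1) unfolding cf_interval_enforceable_def by blast
  then show ?thesis
    unfolding jointly_interval_representable_def using ex GH(1) by blast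
qed

lemma one_element_lattice_is_interval:
  fixes L :: "nat gorder"
  assumes fl: "finite_lattice L" and one: "card (carrier L) = 1"
  shows "\<exists>(G :: nat monoid) H. finite_group G \<and> subgroup H G \<and>
           lattice_isomorphic L (subgroup_interval G H)"
proof -
  define G :: "nat monoid" where "G = singleton_group 0"
  interpret group G by (simp add: G_def)
  have "{K. subgroup K G \<and> carrier G \<subseteq> K} = {carrier G}"
    using subgroup.subset subgroup_self by blast
  then have car: "carrier (subgroup_interval G (carrier G)) = {carrier G}"
    by (simp add: subgroup_interval_def)
  obtain a where a: "carrier L = {a}" using one card_1_singletonE by blast
  interpret L: lattice L using fl by (simp add: finite_lattice_def)
  have "lattice_isomorphic L (subgroup_interval G (carrier G))"
    unfolding lattice_isomorphic_def car
    by (intro exI[of _ "\<lambda>_. carrier G"]) (auto simp: a bij_betw_def subgroup_interval_def)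
  moreover have "finite_group G" using is_group by (simp add: finite_group_def G_def)
  ultimately show ?thesis using subgroup_self by blast
qed

text \<open>
  The hypothesis is applied to the triple \<open>L, M, M\<close>, where \<open>M\<close> is the parachute of two copies of \<open>L\<close>.
  The lattice \<open>L\<close> alone would not do when it has just two elements.
\<close>

lemma every_finite_lattice_is_interval_if:
  assumes C: "\<And>(n :: nat) L \<XX>. n \<ge> 2 \<Longrightarrow>
      (\<forall>i\<in>{1..n}. finite_lattice (L i) \<and> card (carrier (L i)) \<ge> 2) \<Longrightarrow>
      (\<exists>i\<in>{1..n}. \<exists>j\<in>{1..n}. i \<noteq> j \<and> card (carrier (L i)) > 2 \<and> card (carrier (L j)) > 2) \<Longrightarrow>
      (\<forall>i\<in>{1..n}. cf_interval_enforceable (\<XX> i) (L i)) \<Longrightarrow>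
      jointly_interval_representable n L \<XX>"
  shows every_finite_lattice_is_interval
  unfolding every_finite_lattice_is_interval_def
proof (intro allI impI)
  fix L :: "nat gorder"
  assume L: "finite_lattice L"
  show "\<exists>(G :: nat monoid) H. finite_group G \<and> subgroup H G \<and>
           lattice_isomorphic L (subgroup_interval G H)"
  proof (cases "card (carrier L) \<ge> 2")
    case False
    moreover have "card (carrier L) > 0"
      using L by (simp add: finite_lattice_def card_gt_0_iff)
    ultimately have "card (carrier L) = 1" by linarith
    then show ?thesis by (rule one_element_lattice_is_interval[OF L])
  next
    case True
    interpret P: lattice_family "UNIV :: bool set" "\<lambda>_. L"
      by unfold_locales (use L True in auto)
    obtain M :: "nat gorder" where
      M: "finite_lattice M" "lattice_isomorphic (family_order P.parachute) M"
      using finite_lattice_nat_copy[OF P.finite_lattice_parachute] .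
    obtain b where b: "b \<in> carrier L" "P.node True b \<noteq> P.canopy"
      using P.bottom_node[OF UNIV_I[of True]] by metis
    obtain c where c: "c \<in> carrier L" "P.node False c \<noteq> P.canopy"
      using P.bottom_node[OF UNIV_I[of False]] by metis
    have "P.node True b \<inter> P.node False c = {}"
      by (rule P.node_disjoint[OF _ b(2) c(2)]) simp
    then have ne: "P.node True b \<noteq> P.node False c" "{} \<noteq> P.node True b" "{} \<noteq> P.node False c"
      using P.node_nonempty[of True b] P.node_nonempty[of False c] b(1) c(1) by auto
    have "card {{}, P.node True b, P.node False c} = 3" using ne by simp
    moreover have "{{}, P.node True b, P.node False c} \<subseteq> P.parachute"
      using b(1) c(1) by (auto simp: P.parachute_def)
    moreover have "finite P.parachute"
      using P.finite_lattice_parachute by (simp add: finite_lattice_def family_order_def)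
    ultimately have "3 \<le> card P.parachute" by (metis card_mono)
    also have "card P.parachute = card (carrier M)"
      using M(2) by (auto simp: lattice_isomorphic_def family_order_def dest: bij_betw_same_card)
    finally have large: "3 \<le> card (carrier M)" .
    let ?K = "\<lambda>i::nat. if i = 1 then L else M" and ?X = "{G :: nat monoid. finite_group G}"
    have iso_fin: "finite_group K" if "group K" "G \<cong> K" "finite_group G" for G K :: "nat monoid"
      using that by (auto simp: finite_group_def is_iso_def iso_def dest: bij_betw_finite)
    then have enf: "cf_interval_enforceable ?X N" for N
      by (auto simp: cf_interval_enforceable_def group_class_def)
    have "jointly_interval_representable 3 ?K (\<lambda>_. ?X)"
    proof (rule C)
      show "\<exists>i\<in>{1..3}. \<exists>j\<in>{1..3}. i \<noteq> j \<and> card (carrier (?K i)) > 2 \<and> card (carrier (?K j)) > 2"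
        by (rule bexI[of _ 2], rule bexI[of _ 3]) (use large in auto)
    qed (use L M(1) True large enf in auto)
    then obtain G :: "nat monoid" where G: "finite_group G"
      and rep: "\<forall>i\<in>{1..3}. \<exists>H. subgroup H G \<and> lattice_isomorphic (?K i) (subgroup_interval G H)"
      unfolding jointly_interval_representable_def by metis
    show ?thesis using G bspec[OF rep, of 1] by auto
  qed
qed

theorem theorem3p6:
  shows "(\<forall>L :: nat gorder. finite_lattice L \<longrightarrow>
            (\<exists>(G :: nat monoid) H. finite_group G \<and> subgroup H G \<and>
               lattice_isomorphic L (subgroup_interval G H)))
     \<longleftrightarrow>
         (\<forall>(n :: nat) (L :: nat \<Rightarrow> nat gorder) (\<XX> :: nat \<Rightarrow> nat monoid set).
            n \<ge> 2 \<and>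
            (\<forall>i\<in>{1..n}. finite_lattice (L i) \<and> card (carrier (L i)) \<ge> 2) \<and>
            (\<exists>i\<in>{1..n}. \<exists>j\<in>{1..n}. i \<noteq> j \<and> card (carrier (L i)) > 2 \<and> card (carrier (L j)) > 2) \<and>
            (\<forall>i\<in>{1..n}. cf_interval_enforceable (\<XX> i) (L i)) \<longrightarrow>
            (\<exists>G. finite_group G \<and> G \<in> (\<Inter>i\<in>{1..n}. \<XX> i) \<and>
               (\<forall>i\<in>{1..n}. \<exists>H. subgroup H G \<and>
                  lattice_isomorphic (L i) (subgroup_interval G H) \<and>
                  (\<forall>Y. subgroup Y G \<and> H \<subseteq> Y \<and> Y \<subset> carrier G \<longrightarrow> core_free G Y))))"
  unfolding every_finite_lattice_is_interval_def[symmetric]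
    jointly_interval_representable_def[symmetric]
proof (intro iffI allI impI; (elim conjE)?)
  fix n :: nat and L :: "nat \<Rightarrow> nat gorder" and \<XX> :: "nat \<Rightarrow> nat monoid set"
  assume every_finite_lattice_is_interval
    "\<forall>i\<in>{1..n}. finite_lattice (L i) \<and> card (carrier (L i)) \<ge> 2"
    "\<exists>i\<in>{1..n}. \<exists>j\<in>{1..n}. i \<noteq> j \<and> card (carrier (L i)) > 2 \<and> card (carrier (L j)) > 2"
    "\<forall>i\<in>{1..n}. cf_interval_enforceable (\<XX> i) (L i)"
  then show "jointly_interval_representable n L \<XX>"
    by (rule jointly_interval_representable_if)
qed (rule every_finite_lattice_is_interval_if, simp)

end
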